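(* Let $I\subset\mathbb{R}$ be a compact nondegenerate interval, let $\mathcal{F}_1$ be the set of all continuous maps $f:I\to I$ that do not admit a $2$-cycle, let $\mathbb{P}$ be the set of all orbit-patterns available in $\mathcal{F}_1$, and let $J=\{L,R\}^{\mathbb{N}}\cup\{L,R\}^{*}$. Then $\mathbb{P}$ is naturally indexed by $J$: the map $\phi:\mathbb{P}\to J$ which sends the order-pattern of an orbit $(x_n)_{n\ge 1}$ of a map in $\mathcal{F}_1$ to the $L$-$R$-tag of $(x_n)_{n\geq 1}$ is well defined and is a bijection.
   Context: A $2$-cycle of $f$ is a pair of distinct points $u\neq v$ with $f(u)=v$ and $f(v)=u$. Two real sequences $(a_n)$ and $(b_n)$ with the same index set have the same order-pattern if, for all indices $m,n$, $a_m<a_n \iff b_m<b_n$. An order-pattern is an equivalence class of real sequences under this relation. An orbit of $f:I\to I$ is a sequence $(x_n)_{n\ge1}$ in $I$ with $x_{n+1}=f(x_n)$ for all $n\ge 1$; its order-pattern is called an orbit-pattern. $\mathbb{P}$ is the set of the order-patterns of all orbits of all $f\in\mathcal{F}_1$. $\{L,R\}^{\mathbb{N}}$ is the set of all infinite sequences over $\{L,R\}$, and $\{L,R\}^{*}$ is the set of all finite words over $\{L,R\}$, including the empty word. It is known that every orbit $(x_n)_{n\ge1}$ of a map $f\in\mathcal{F}_1$ converges to some $p\in I$ with $f(p)=p$. The $L$-$R$-tag of such an orbit is defined as follows. Each term $x_i\neq p$ is labeled $L$ if $x_{i+1}<x_i$ and $R$ if $x_{i+1}>x_i$. If $x_i\ne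 p$ for all $i$, the tag is the infinite sequence of labels of $x_1,x_2,x_3,\dots$. If some term equals $p$ and $k$ is the least index with $x_k=p$, the tag is the word of length $k-1$ formed by the labels of $x_1,\dots,x_{k-1}$ (so the orbit of a fixed point has the empty word as its tag). *)

theory Defs
  imports Complex_Main
begin

text \<open>
  Maps \<open>I \<rightarrow> I\<close> are total functions on the reals of which only the behaviour on the carrier
  \<open>I\<close> is ever used.
\<close>

definition two_cycle_on :: "real set \<Rightarrow> (real \<Rightarrow> real) \<Rightarrow> real \<Rightarrow> real \<Rightarrow> bool" where
  "two_cycle_on I f u v \<longleftrightarrow> u \<in> I \<and> v \<in> I \<and> u \<noteq> v \<and> f u = v \<and> f v = u"

definition F1 :: "real set \<Rightarrow> (real \<Rightarrow> real) set" where
  "F1 I = {f. continuous_on I f \<and> f ` I \<subseteq> I \<and> \<not> (\<exists>u v. two_cycle_on I f u v)}"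

text \<open>
  Sequences are indexed from 0: the term written \<open>x\<^sub>n\<close> with \<open>n \<ge> 1\<close> in the mathematical
  text is \<open>x (n - 1)\<close>.
\<close>

definition is_orbit :: "real set \<Rightarrow> (real \<Rightarrow> real) \<Rightarrow> (nat \<Rightarrow> real) \<Rightarrow> bool" where
  "is_orbit I f x \<longleftrightarrow> (\<forall>n. x n \<in> I \<and> x (Suc n) = f (x n))"

definition same_order_pattern :: "((nat \<Rightarrow> real) \<times> (nat \<Rightarrow> real)) set" where
  "same_order_pattern = {(a, b). \<forall>m n. a m < a n \<longleftrightarrow> b m < b n}"

lemma equiv_same_order_pattern: "equiv UNIV same_order_pattern"
  by (intro equivI refl_onI symI transI) (auto simp: same_order_pattern_def)

definition order_pattern :: "(nat \<Rightarrow> real) \<Rightarrow> (nat \<Rightarrow> real) set" where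
  "order_pattern x = same_order_pattern `` {x}"

definition orbit_patterns :: "real set \<Rightarrow> (nat \<Rightarrow> real) set set" where
  "orbit_patterns I = {order_pattern x | f x. f \<in> F1 I \<and> is_orbit I f x}"

datatype label = L | R

text \<open>\<open>Inl\<close> injects the infinite sequences and \<open>Inr\<close> the finite words.\<close>

type_synonym tag = "(nat \<Rightarrow> label) + label list"

definition J :: "tag set" where
  "J = (UNIV :: (nat \<Rightarrow> label) set) <+> (UNIV :: label list set)"

text \<open>
  The label is only meaningful at terms different from the limit of the orbit; at such a term
  of a convergent orbit of a continuous map, \<open>x (Suc i) \<noteq> x i\<close>.
\<close>

definition label_at :: "(nat \<Rightarrow> real) \<Rightarrow> nat \<Rightarrow> label" where
  "label_at x i = (if x (Suc i) < x i then L else R)"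

text \<open>
  The tag depends on the orbit only, not on the map, because the fixed point it refers to is
  the limit of the orbit.  If \<open>k\<close> is the least 0-based index at which the limit is attained,
  there are exactly \<open>k\<close> earlier terms, so the finite tag has length \<open>k\<close>.
\<close>

definition LR_tag :: "(nat \<Rightarrow> real) \<Rightarrow> tag" where
  "LR_tag x = (let p = lim x in
     if \<forall>i. x i \<noteq> p then Inl (label_at x)
     else Inr (map (label_at x) [0..<(LEAST k. x k = p)]))"

end

(*
  Without 2-cycles, an orbit stays forever above each of its R-terms and forever below each of
  its L-terms (Coppel).  Hence the label of a term decides how it compares with all later terms,
  and R-terms increase while L-terms decrease; if both kinds occur infinitely often, their limits
  are exchanged by the map, so they coincide and the orbit converges.  The limit is attained
  exactly when two consecutive terms are equal, which is visible in the order-pattern.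
  Conversely, signs s_i in {1, 0, -1} coding a given tag are realized by the orbit s_i / 2^i of a
  continuous map with |f y| <= |y| / 2, and such a map has no 2-cycle.
*)

theory Submission
  imports Defs "HOL-Analysis.Analysis"
begin

section \<open>Orbits stay on one side of each of their terms\<close>

lemma F1D:
  assumes "f \<in> F1 {a..b}"
  shows "continuous_on {a..b} f" "\<And>x. x \<in> {a..b} \<Longrightarrow> f x \<in> {a..b}"
    "\<And>u. u \<in> {a..b} \<Longrightarrow> f (f u) = u \<Longrightarrow> f u = u"
  using assms unfolding F1_def two_cycle_on_def by blast+

lemma F1I:
  assumes "continuous_on {a..b} f" "\<And>x. x \<in> {a..b} \<Longrightarrow> f x \<in> {a..b}"
    "\<And>u. u \<in> {a..b} \<Longrightarrow> f (f u) = u \<Longrightarrow> f u = u"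
  shows "f \<in> F1 {a..b}"
  unfolding F1_def two_cycle_on_def mem_Collect_eq image_subset_iff
  using assms by metis

text \<open>Conjugation by negation swaps the two sides of the diagonal, so results for points above
  it carry over to points below it.\<close>

lemma F1_reflect:
  assumes "f \<in> F1 {a..b}"
  shows "(\<lambda>x. - f (- x)) \<in> F1 {- b..- a}"
proof -
  note f = F1D[OF assms]
  have "continuous_on {- b..- a} (\<lambda>x. - f (- x))"
    by (intro continuous_intros continuous_on_compose2[OF f(1)]) auto
  moreover have "- f (- x) \<in> {- b..- a}" if "x \<in> {- b..- a}" for x
    using f(2)[of "- x"] that by auto
  moreover have "- f (- u) = u" if "u \<in> {- b..- a}" "- f (- (- f (- u))) = u" for u
    using f(3)[of "- u"] that by fastforce
  ultimately show ?thesis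
    by (intro F1I) auto
qed

lemma funpow_reflect:
  fixes f :: "real \<Rightarrow> real"
  shows "((\<lambda>x. - f (- x)) ^^ n) (- x) = - (f ^^ n) x"
  by (induction n) auto

lemma funpow_in_F1:
  assumes "f \<in> F1 {a..b}" "x \<in> {a..b}"
  shows "(f ^^ n) x \<in> {a..b}"
  by (induction n) (use assms F1D(2) in auto)

lemma above_diag_propagates:
  fixes f :: "real \<Rightarrow> real"
  assumes "continuous_on {u..v} f" "\<And>t. t \<in> {u..v} \<Longrightarrow> f t \<noteq> t"
    and "s \<in> {u..v}" "t \<in> {u..v}" "f s > s"
  shows "f t > t"
proof (rule ccontr)
  assume "\<not> f t > t"
  with assms have ft: "f t \<le> t" by simp
  have cont: "continuous_on {u..v} (\<lambda>t. f t - t)"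
    by (intro continuous_intros assms)
  have "connected ((\<lambda>t. f t - t) ` {u..v})"
    using cont by (intro connected_continuous_image) auto
  then have "0 \<in> (\<lambda>t. f t - t) ` {u..v}"
    by (rule connectedD_interval[where x = "f t - t" and y = "f s - s"]) (use assms ft in auto)
  then show False using assms(2) by force
qed

text \<open>Suppose \<open>f (f z) <= z\<close>. If some \<open>t <= z\<close> has
  \<open>f (f t) >= t\<close> and no fixed point of \<open>f\<close> lies in \<open>{t..z}\<close>,
  the intermediate value theorem for \<open>f (f s) - s\<close> produces a 2-cycle. The left
  endpoint \<open>a\<close> is such a \<open>t\<close> unless a fixed point lies in
  \<open>{a..z}\<close>; in that case a point just to the right of the last one is.\<close>

lemma F1_second_iterate_above:
  assumes f: "f \<in> F1 {a..b}" and z: "z \<in> {a..b}" and above: "f z > z"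
  shows "f (f z) > z"
proof (rule ccontr)
  assume "\<not> f (f z) > z"
  then have ffz: "f (f z) \<le> z" by simp
  note fD = F1D[OF f]
  have cont_ff: "continuous_on {a..b} (\<lambda>t. f (f t))"
    by (rule continuous_on_compose2[OF fD(1) fD(1)]) (use fD(2) in auto)
  have no_t: False
    if t: "t \<in> {a..z}" "f (f t) \<ge> t" and nofix: "\<And>s. s \<in> {t..z} \<Longrightarrow> f s \<noteq> s" for t
  proof -
    have "\<exists>s\<ge>t. s \<le> z \<and> f (f s) - s = 0"
    proof (rule IVT2')
      show "continuous_on {t..z} (\<lambda>s. f (f s) - s)"
        by (intro continuous_intros continuous_on_subset[OF cont_ff]) (use t z in auto)
    qed (use t ffz in auto)
    then obtain s where "s \<in> {t..z}" "f (f s) = s" by auto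
    then show False using fD(3)[of s] nofix[of s] t z by auto
  qed
  show False
  proof (cases "\<exists>s\<in>{a..z}. f s = s")
    case False
    have "a \<in> {a..b}" using z by auto
    then have "f (f a) \<ge> a" using fD(2) by (metis atLeastAtMost_iff)
    then show False using no_t[of a] False z by auto
  next
    case True
    define Fix where "Fix = {s \<in> {a..z}. f s - s = 0}"
    have cont: "continuous_on {a..z} f"
      by (rule continuous_on_subset[OF fD(1)]) (use z in auto)
    have "closed Fix"
      unfolding Fix_def
      by (intro continuous_closed_preimage_constant continuous_intros cont closed_atLeastAtMost)
    moreover have "Fix \<noteq> {}" "bdd_above Fix"
      using True by (auto simp: Fix_def intro!: bdd_aboveI[of _ z])
    ultimately have SupFix: "Sup Fix \<in> Fix"
      by (intro closed_contains_Sup)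
    define u where "u = Sup Fix"
    have u: "u \<in> {a..z}" "f u = u" using SupFix by (auto simp: Fix_def u_def)
    then have "u < z" using above by (cases "u = z") auto
    have nofix: "f s \<noteq> s" if "u < s" "s \<le> z" for s
    proof
      assume "f s = s"
      then have "s \<in> Fix" using that u by (auto simp: Fix_def)
      then have "s \<le> u" unfolding u_def using \<open>bdd_above Fix\<close> by (rule cSup_upper)
      then show False using that by simp
    qed
    have pos: "f s > s" if "u < s" "s \<le> z" for s
    proof (rule above_diag_propagates[where u = s and v = z and s = z])
      show "continuous_on {s..z} f" by (rule continuous_on_subset[OF cont]) (use that u in auto)
    qed (use that nofix above in auto)
    obtain d where d: "d > 0" "\<And>t. t \<in> {a..z} \<Longrightarrow> dist t u < d \<Longrightarrow> dist (f t) (f u) < z - u"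
      using cont u \<open>u < z\<close> unfolding continuous_on_iff by (metis diff_gt_0_iff_gt)
    \<comment> \<open>So close to \<open>u\<close>, the image \<open>f t\<close> stays below
      \<open>z\<close>, in the region where \<open>f\<close> is above the diagonal; both steps from
      \<open>t\<close> then go up.\<close>
    define t where "t = min z (u + d / 2)"
    have t: "u < t" "t \<le> z" "t \<in> {a..z}" "dist t u < d"
      using d(1) \<open>u < z\<close> u by (auto simp: t_def dist_real_def)
    have "f t < z" using d(2)[OF t(3,4)] u by (auto simp: dist_real_def)
    then have "f (f t) > f t" using pos[of "f t"] pos[of t] t by auto
    then have "f (f t) \<ge> t" using pos[of t] t by auto
    then show False using no_t[of t] t nofix by auto
  qed
qed

text \<open>
  In a counterexample of least length \<open>n\<close> the term \<open>f x\<close> lies below the diagonal, so minimality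
  gives \<open>f\<^sup>n\<^sup>-\<^sup>1 x \<le> f x\<close>; hence \<open>f\<^sup>n\<^sup>-\<^sup>1 x\<close> is the image of some \<open>z\<close> between \<open>x\<close> and the next
  fixed point, and \<open>z\<close> contradicts the case \<open>n = 2\<close>.
\<close>

lemma F1_iterates_above:
  assumes "f \<in> F1 {a..b}" "x \<in> {a..b}" "f x > x" "n > 0"
  shows "(f ^^ n) x > x"
  using assms
proof (induction n arbitrary: a b f x rule: less_induct)
  case (less n)
  note fD = F1D[OF less.prems(1)]
  \<comment> \<open>The induction ranges over all intervals and maps, so its hypothesis also applies
    to the reflected map.\<close>
  have below: "(f ^^ m) y < y" if "m < n" "m > 0" "y \<in> {a..b}" "f y < y" for m y
    using less.IH[of m "\<lambda>x. - f (- x)" "- b" "- a" "- y"] F1_reflect[OF less.prems(1)] that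
    by (auto simp: funpow_reflect)
  show ?case
  proof (rule ccontr)
    assume "\<not> (f ^^ n) x > x"
    then have fn: "(f ^^ n) x \<le> x" by simp
    have "n \<noteq> 1" using fn less.prems by auto
    then obtain m where n: "n = Suc (Suc m)"
      using less.prems(4) by (metis One_nat_def not0_implies_Suc less_numeral_extra(3))
    have shift: "(f ^^ Suc k) x = (f ^^ k) (f x)" for k
      by (simp add: funpow_swap1)
    have fx: "f x \<in> {a..b}" using fD(2) less.prems by blast
    have le: "(f ^^ Suc m) x \<le> f x"
    proof (cases "m = 0")
      case False
      show ?thesis
      proof (cases "f (f x)" "f x" rule: linorder_cases)
        case less
        then show ?thesis using below[of m "f x"] False n fx unfolding shift by auto
      next
        case equal
        have "(f ^^ k) (f x) = f x" for k
          by (induction k) (use equal in auto)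
        then show ?thesis unfolding shift by simp
      next
        \<comment> \<open>This case is impossible: the induction hypothesis at \<open>f x\<close>
          gives \<open>(f ^^ n) x > f x > x\<close>, against \<open>fn\<close>.\<close>
        case greater
        have "(f ^^ Suc m) (f x) > f x"
          by (rule less.IH[OF _ less.prems(1) fx greater]) (use n in auto)
        then show ?thesis using fn less.prems(3) unfolding n shift[of "Suc m"] by linarith
      qed
    qed simp
    define w where "w = (f ^^ Suc m) x"
    have w: "w \<in> {a..b}" "w > x" "w \<le> f x" "f w \<le> x"
      using funpow_in_F1[OF less.prems(1,2), of "Suc m"] le fn n less.IH[of "Suc m" f a b x] less.prems
      by (auto simp: w_def)
    have cont: "continuous_on {x..w} f"
      by (rule continuous_on_subset[OF fD(1)]) (use w less.prems in auto)
    define S where "S = {s \<in> {x..w}. f s - s = 0}"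
    have "closed S"
      unfolding S_def by (intro continuous_closed_preimage_constant continuous_intros cont closed_atLeastAtMost)
    \<comment> \<open>The graph must cross the diagonal, since \<open>f x > x\<close> but
      \<open>f w <= x < w\<close>.\<close>
    moreover have "S \<noteq> {}"
      using above_diag_propagates[OF cont, of x w] w less.prems(3) by (force simp: S_def)
    moreover have bdd: "bdd_below S" by (auto simp: S_def intro!: bdd_belowI[of _ x])
    ultimately have "Inf S \<in> S" by (intro closed_contains_Inf)
    define p where "p = Inf S"
    have p: "p \<in> {x..w}" "f p = p" using \<open>Inf S \<in> S\<close> by (auto simp: S_def p_def)
    have "\<exists>z\<ge>x. z \<le> p \<and> f z = w"
      by (rule IVT2') (use p w continuous_on_subset[OF cont] in auto)
    then obtain z where z: "z \<in> {x..p}" "f z = w" by auto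
    then have "z < w" using p w by (cases "z = w") auto
    then have "f (f z) > z"
      using F1_second_iterate_above[OF less.prems(1), of z] z p w less.prems(2) by auto
    then show False using z w by auto
  qed
qed

lemma F1_iterates_below:
  assumes "f \<in> F1 {a..b}" "x \<in> {a..b}" "f x < x" "n > 0"
  shows "(f ^^ n) x < x"
  using F1_iterates_above[OF F1_reflect[OF assms(1)], of "- x" n] assms
  by (auto simp: funpow_reflect)

lemma orbit_funpow:
  assumes "is_orbit I f x"
  shows "x (i + n) = (f ^^ n) (x i)"
  by (induction n) (use assms in \<open>auto simp: is_orbit_def\<close>)

section \<open>Convergence of orbits\<close>

lemma frequently_switch:
  fixes P :: "nat \<Rightarrow> bool"
  assumes "\<forall>N. \<exists>i\<ge>N. P i" "\<forall>N. \<exists>i\<ge>N. \<not> P i"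
  shows "\<exists>i\<ge>N. P i \<and> \<not> P (Suc i)"
proof (rule ccontr)
  assume no: "\<not> ?thesis"
  obtain i where i: "i \<ge> N" "P i" using assms by blast
  have "P j" if "i \<le> j" for j
    using that by (induction j rule: dec_induct) (use no i in auto)
  then show False using assms(2) by blast
qed

locale F1_orbit =
  fixes a b :: real and f :: "real \<Rightarrow> real" and x :: "nat \<Rightarrow> real"
  assumes f: "f \<in> F1 {a..b}" and x: "is_orbit {a..b} f x"
begin

lemma x_in: "x i \<in> {a..b}" and x_Suc: "x (Suc i) = f (x i)"
  using x by (auto simp: is_orbit_def)

lemma later_above: "x i < x (Suc i) \<Longrightarrow> i < j \<Longrightarrow> x i < x j"
  using F1_iterates_above[OF f x_in, of i "j - i"] orbit_funpow[OF x, of i "j - i"]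
  by (simp add: x_Suc)

lemma later_below: "x (Suc i) < x i \<Longrightarrow> i < j \<Longrightarrow> x j < x i"
  using F1_iterates_below[OF f x_in, of i "j - i"] orbit_funpow[OF x, of i "j - i"]
  by (simp add: x_Suc)

lemma later_equal: "x (Suc i) = x i \<Longrightarrow> i \<le> j \<Longrightarrow> x j = x i"
  by (rotate_tac, induction j rule: dec_induct) (auto simp: x_Suc)

text \<open>Consecutive terms form points of the graph of \<open>f\<close>, which is closed by
  continuity. Approximation by some terms suffices, so this applies before convergence of the orbit
  is known.\<close>

lemma accumulation_step:
  assumes q: "q \<in> {a..b}"
    and near: "\<And>e. e > 0 \<Longrightarrow> \<exists>i. \<bar>x i - q\<bar> < e \<and> \<bar>x (Suc i) - r\<bar> < e"
  shows "f q = r"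
proof (rule ccontr)
  assume "f q \<noteq> r"
  define e where "e = \<bar>f q - r\<bar> / 2"
  have "e > 0" using \<open>f q \<noteq> r\<close> by (simp add: e_def)
  then obtain d where d: "d > 0" "\<And>t. t \<in> {a..b} \<Longrightarrow> dist t q < d \<Longrightarrow> dist (f t) (f q) < e"
    using F1D(1)[OF f] q unfolding continuous_on_iff by metis
  obtain i where i: "\<bar>x i - q\<bar> < min d e" "\<bar>x (Suc i) - r\<bar> < min d e"
    using near[of "min d e"] d(1) \<open>e > 0\<close> by auto
  have "\<bar>f (x i) - f q\<bar> < e" using d(2)[OF x_in[of i]] i by (simp add: dist_real_def)
  then show False using i x_Suc[of i] unfolding e_def by (auto simp: abs_if split: if_splits)
qed

lemma convergent_alternating:
  assumes ne: "\<And>i. x (Suc i) \<noteq> x i"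
    and up: "\<forall>N. \<exists>i\<ge>N. x i < x (Suc i)" and down: "\<forall>N. \<exists>i\<ge>N. \<not> x i < x (Suc i)"
  shows "convergent x"
proof -
  \<comment> \<open>\<open>U\<close> holds the R-terms and \<open>D\<close> the L-terms;
    \<open>r = Sup U\<close> and \<open>q = Inf D\<close> will be the limits of these two monotone
    subsequences.\<close>
  define U where "U = x ` {i. x i < x (Suc i)}"
  define D where "D = x ` {i. x (Suc i) < x i}"
  have below: "(\<not> x i < x (Suc i)) \<longleftrightarrow> x (Suc i) < x i" for i
    using ne[of i] by auto
  have nonempty: "U \<noteq> {}" "D \<noteq> {}"
    using up down unfolding U_def D_def below by blast+
  have UD: "s \<le> t" if "s \<in> U" "t \<in> D" for s t
  proof -
    obtain i j where ij: "s = x i" "x i < x (Suc i)" "t = x j" "x (Suc j) < x j"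
      using \<open>s \<in> U\<close> \<open>t \<in> D\<close> by (auto simp: U_def D_def)
    then show ?thesis
      using later_above[of i j] later_below[of j i] by (cases i j rule: linorder_cases) auto
  qed
  define r where "r = Sup U"
  define q where "q = Inf D"
  have bdd: "bdd_above U" "bdd_below D"
    using x_in by (auto simp: U_def D_def intro!: bdd_aboveI[of _ b] bdd_belowI[of _ a])
  have rU: "s \<le> r" if "s \<in> U" for s unfolding r_def using that bdd by (intro cSup_upper)
  have qD: "q \<le> t" if "t \<in> D" for t unfolding q_def using that bdd by (intro cInf_lower)
  have "r \<le> q" unfolding r_def q_def using nonempty UD
    by (intro cSup_least cInf_greatest) auto
  have rq_in: "r \<in> {a..b}" "q \<in> {a..b}"
  proof -
    obtain s t where "s \<in> U" "t \<in> D" using nonempty by auto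
    then have "a \<le> s" "t \<le> b" using x_in by (auto simp: U_def D_def)
    then show "r \<in> {a..b}" "q \<in> {a..b}"
      using rU[OF \<open>s \<in> U\<close>] qD[OF \<open>t \<in> D\<close>] \<open>r \<le> q\<close> by auto
  qed
  \<comment> \<open>Once some R-term exceeds \<open>r - e\<close>, \<open>later_above\<close> keeps
    all later R-terms between it and \<open>r\<close>; L-terms behave symmetrically.\<close>
  have close: "\<exists>N. \<forall>i\<ge>N. (x i < x (Suc i) \<longrightarrow> \<bar>x i - r\<bar> < e) \<and> (x (Suc i) < x i \<longrightarrow> \<bar>x i - q\<bar> < e)"
    if "e > 0" for e
  proof -
    have "\<exists>s\<in>U. r - e < s" unfolding r_def
      using less_cSup_iff[OF nonempty(1) bdd(1), of "Sup U - e"] that by auto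
    then obtain k where k: "x k < x (Suc k)" "r - e < x k" by (auto simp: U_def)
    have "\<exists>t\<in>D. t < q + e" unfolding q_def
      using cInf_less_iff[OF nonempty(2) bdd(2), of "Inf D + e"] that by auto
    then obtain l where l: "x (Suc l) < x l" "x l < q + e" by (auto simp: D_def)
    show ?thesis
    proof (intro exI[of _ "Suc (max k l)"] allI impI conjI)
      fix i assume "Suc (max k l) \<le> i"
      then have i: "k < i" "l < i" by auto
      { assume "x i < x (Suc i)"
        then have "x i \<le> r" using rU by (auto simp: U_def)
        then show "\<bar>x i - r\<bar> < e" using later_above[OF k(1) i(1)] k(2) by simp }
      { assume "x (Suc i) < x i"
        then have "q \<le> x i" using qD by (auto simp: D_def)
        then show "\<bar>x i - q\<bar> < e" using later_below[OF l(1) i(2)] l(2) by simp }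
    qed
  qed
  \<comment> \<open>At a late switch from L to R, \<open>x i\<close> is near \<open>q\<close> and
    its image is near \<open>r\<close>.\<close>
  have "f q = r"
  proof (rule accumulation_step[OF rq_in(2)])
    fix e :: real assume "e > 0"
    then obtain N where N: "\<And>i. i \<ge> N \<Longrightarrow> x i < x (Suc i) \<Longrightarrow> \<bar>x i - r\<bar> < e"
      "\<And>i. i \<ge> N \<Longrightarrow> x (Suc i) < x i \<Longrightarrow> \<bar>x i - q\<bar> < e"
      using close by metis
    obtain i where "i \<ge> N" "\<not> x i < x (Suc i)" "x (Suc i) < x (Suc (Suc i))"
      using frequently_switch[of "\<lambda>i. \<not> x i < x (Suc i)" N] up down by auto
    then show "\<exists>i. \<bar>x i - q\<bar> < e \<and> \<bar>x (Suc i) - r\<bar> < e"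
      using N(2)[of i] N(1)[of "Suc i"] below by (intro exI[of _ i]) auto
  qed
  moreover have "f r = q"
  proof (rule accumulation_step[OF rq_in(1)])
    fix e :: real assume "e > 0"
    then obtain N where N: "\<And>i. i \<ge> N \<Longrightarrow> x i < x (Suc i) \<Longrightarrow> \<bar>x i - r\<bar> < e"
      "\<And>i. i \<ge> N \<Longrightarrow> x (Suc i) < x i \<Longrightarrow> \<bar>x i - q\<bar> < e"
      using close by metis
    obtain i where "i \<ge> N" "x i < x (Suc i)" "\<not> x (Suc i) < x (Suc (Suc i))"
      using frequently_switch[of "\<lambda>i. x i < x (Suc i)" N] up down by auto
    then show "\<exists>i. \<bar>x i - r\<bar> < e \<and> \<bar>x (Suc i) - q\<bar> < e"
      using N(1)[of i] N(2)[of "Suc i"] below by (intro exI[of _ i]) auto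
  qed
  \<comment> \<open>Otherwise \<open>q\<close> and \<open>r\<close> would form a 2-cycle.\<close>
  ultimately have "q = r" using F1D(3)[OF f rq_in(1)] by simp
  have "x \<longlonglongrightarrow> r"
  proof (rule LIMSEQ_I)
    fix e :: real assume "e > 0"
    with close obtain N where
      "\<forall>i\<ge>N. (x i < x (Suc i) \<longrightarrow> \<bar>x i - r\<bar> < e) \<and> (x (Suc i) < x i \<longrightarrow> \<bar>x i - q\<bar> < e)"
      by blast
    then show "\<exists>N. \<forall>n\<ge>N. norm (x n - r) < e"
      using \<open>q = r\<close> below by (intro exI[of _ N]) (metis real_norm_def)
  qed
  then show ?thesis by (rule convergentI)
qed

lemma x_convergent: "convergent x"
proof -
  have shift: "convergent x" if "convergent (\<lambda>i. x (i + N))" for N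
    using that convergent_ignore_initial_segment[of x N] by simp
  have bounds: "Bseq (\<lambda>i. x (i + N))" for N
  proof (rule BseqI')
    show "norm (x (i + N)) \<le> max \<bar>a\<bar> \<bar>b\<bar>" for i
      using x_in[of "i + N"] by auto
  qed
  \<comment> \<open>Apart from a repetition, either one label prevails eventually, and a bounded
    monotone tail converges, or both labels recur forever.\<close>
  consider (const) i where "x (Suc i) = x i"
    | (up) N where "\<And>i. i \<ge> N \<Longrightarrow> x i < x (Suc i)"
    | (down) N where "\<And>i. i \<ge> N \<Longrightarrow> x (Suc i) \<le> x i"
    | (alt) "\<And>i. x (Suc i) \<noteq> x i" "\<forall>N. \<exists>i\<ge>N. x i < x (Suc i)" "\<forall>N. \<exists>i\<ge>N. \<not> x i < x (Suc i)"
    by (metis not_le)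
  then show ?thesis
  proof cases
    case const
    have "(\<lambda>j. x (j + i)) = (\<lambda>_. x i)" by (rule ext, rule later_equal[OF const]) simp
    then show ?thesis by (intro shift[of i]) (simp add: convergent_const)
  next
    case up
    then have "incseq (\<lambda>i. x (i + N))" by (intro incseq_SucI) (simp add: less_imp_le)
    then show ?thesis
      by (intro shift[of N] Bseq_monoseq_convergent bounds) (simp add: incseq_imp_monoseq)
  next
    case down
    then have "decseq (\<lambda>i. x (i + N))" by (intro decseq_SucI) simp
    then show ?thesis
      by (intro shift[of N] Bseq_monoseq_convergent bounds) (simp add: decseq_imp_monoseq)
  next
    case alt
    then show ?thesis by (rule convergent_alternating)
  qed
qed

lemma f_lim: "f (lim x) = lim x"
proof -
  have lim: "x \<longlonglongrightarrow> lim x" using x_convergent by (simp add: convergent_LIMSEQ_iff)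
  have "lim x \<in> {a..b}"
    by (rule closed_sequentially[OF _ _ lim]) (use x_in in auto)
  then have "(\<lambda>i. f (x i)) \<longlonglongrightarrow> f (lim x)"
    by (intro continuous_on_tendsto_compose[OF F1D(1)[OF f] lim]) (use x_in in auto)
  moreover have "(\<lambda>i. f (x i)) \<longlonglongrightarrow> lim x"
    using LIMSEQ_Suc[OF lim] by (simp add: x_Suc)
  ultimately show ?thesis by (rule LIMSEQ_unique)
qed

text \<open>The limit is a fixed point, and a repeated term makes the orbit constant from there on.
  Attaining the limit thus becomes a condition that the order-pattern can see.\<close>

lemma eq_lim_iff: "x i = lim x \<longleftrightarrow> x (Suc i) = x i"
proof
  assume const: "x (Suc i) = x i"
  have "(\<lambda>j. x (j + i)) = (\<lambda>_. x i)" by (rule ext, rule later_equal[OF const]) simp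
  then have "x \<longlonglongrightarrow> x i"
    using LIMSEQ_offset[of x i "x i"] by simp
  then show "x i = lim x" by (simp add: limI)
qed (use f_lim x_Suc in auto)

end

section \<open>Tags and order-patterns determine each other\<close>

text \<open>A variant of \<open>LR_tag\<close> in which comparisons of consecutive terms replace the
  limit, so that invariance under \<open>same_order_pattern\<close> is immediate.\<close>

definition pattern_tag :: "(nat \<Rightarrow> real) \<Rightarrow> tag" where
  "pattern_tag x = (if \<forall>i. x (Suc i) \<noteq> x i then Inl (label_at x)
     else Inr (map (label_at x) [0..<(LEAST k. x (Suc k) = x k)]))"

lemma (in F1_orbit) LR_tag_eq_pattern_tag: "LR_tag x = pattern_tag x"
  by (simp add: LR_tag_def pattern_tag_def eq_lim_iff)

lemma pattern_tag_cong:
  assumes "(x, y) \<in> same_order_pattern"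
  shows "pattern_tag x = pattern_tag y"
proof -
  have less: "x m < x n \<longleftrightarrow> y m < y n" for m n
    using assms by (auto simp: same_order_pattern_def)
  have "x m = x n \<longleftrightarrow> y m = y n" for m n
    using less by (metis linorder_neq_iff)
  moreover have "label_at x = label_at y" by (simp add: label_at_def less fun_eq_iff)
  ultimately show ?thesis by (simp add: pattern_tag_def)
qed

text \<open>All later terms stay on the side of \<open>x m\<close> chosen by its first step. A
  stationary term also receives the label \<open>R\<close> by default, hence the extra conjunct in
  the first equivalence.\<close>

lemma (in F1_orbit) less_iff_label:
  "m < n \<Longrightarrow> x m < x n \<longleftrightarrow> label_at x m = R \<and> x (Suc m) \<noteq> x m"
  "m < n \<Longrightarrow> x n < x m \<longleftrightarrow> label_at x m = L"
  using later_above[of m n] later_below[of m n] later_equal[of m n]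
  by (cases "x m" "x (Suc m)" rule: linorder_cases; auto simp: label_at_def)+

text \<open>The orbit is constant from its first repetition on, so the length of a finite tag
  determines all stationary indices.\<close>

lemma (in F1_orbit) stationary_iff:
  assumes "\<exists>i. x (Suc i) = x i"
  shows "x (Suc m) = x m \<longleftrightarrow> (LEAST k. x (Suc k) = x k) \<le> m"
proof
  assume "(LEAST k. x (Suc k) = x k) \<le> m"
  moreover have "x (Suc (LEAST k. x (Suc k) = x k)) = x (LEAST k. x (Suc k) = x k)"
    using assms by (rule LeastI_ex)
  ultimately show "x (Suc m) = x m"
    using later_equal[of _ m] later_equal[of _ "Suc m"] by (metis le_SucI)
qed (rule Least_le)

lemma same_order_pattern_if_tag_eq:
  assumes "F1_orbit a b f x" "F1_orbit a b g y" and tag: "pattern_tag x = pattern_tag y"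
  shows "(x, y) \<in> same_order_pattern"
proof -
  interpret x: F1_orbit a b f x by fact
  interpret y: F1_orbit a b g y by fact
  \<comment> \<open>Labels are compared at moving terms only, because a finite tag records no
    others.\<close>
  have step: "(x (Suc m) = x m \<longleftrightarrow> y (Suc m) = y m) \<and>
    (x (Suc m) \<noteq> x m \<longrightarrow> label_at x m = label_at y m)" for m
  proof (cases "\<forall>i. x (Suc i) \<noteq> x i")
    case True
    then show ?thesis using tag by (auto simp: pattern_tag_def split: if_splits)
  next
    case False
    then have ex: "\<exists>i. x (Suc i) = x i" "\<exists>i. y (Suc i) = y i"
      using tag by (auto simp: pattern_tag_def split: if_splits)
    define k where "k = (LEAST k. x (Suc k) = x k)"
    define l where "l = (LEAST k. y (Suc k) = y k)"
    have "pattern_tag x = Inr (map (label_at x) [0..<k])"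
      "pattern_tag y = Inr (map (label_at y) [0..<l])"
      using ex unfolding pattern_tag_def k_def l_def by presburger+
    then have "map (label_at x) [0..<k] = map (label_at y) [0..<l]"
      using tag by simp
    moreover from this have "k = l" by (metis length_map length_upt diff_zero)
    ultimately have "\<And>m. m < k \<Longrightarrow> label_at x m = label_at y m" "k = l" by auto
    then show ?thesis
      using x.stationary_iff[OF ex(1), of m] y.stationary_iff[OF ex(2), of m]
      unfolding k_def[symmetric] l_def[symmetric] by auto
  qed
  \<comment> \<open>Stationary terms carry the default label \<open>R\<close> in both orbits, so the
    labels agree at every index.\<close>
  have L: "label_at x m = L \<longleftrightarrow> label_at y m = L" for m
    using step[of m] by (cases "x (Suc m) = x m") (auto simp: label_at_def)
  have R: "label_at x m = R \<longleftrightarrow> label_at y m = R" for m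
    using L[of m] by (metis label.exhaust label.distinct(1))
  have "x m < x n \<longleftrightarrow> y m < y n" for m n
    by (cases m n rule: linorder_cases)
      (use step[of m] in \<open>auto simp: x.less_iff_label y.less_iff_label L R\<close>)
  then show ?thesis by (auto simp: same_order_pattern_def)
qed

section \<open>Realization of all tags\<close>

text \<open>The interval is symmetric about \<open>p\<close>, so halving distances to
  \<open>p\<close> preserves it. Two steps divide the distance by at least four, so
  \<open>f (f u) = u\<close> forces \<open>u = p\<close>.\<close>

lemma halving_map_in_F1:
  assumes "continuous_on {a..b} f" and p: "p \<in> {a..b}" and ab: "p - a = b - p"
    and half: "\<And>t. \<bar>f t - p\<bar> \<le> \<bar>t - p\<bar> / 2"
  shows "f \<in> F1 {a..b}"
proof -
  have "f t \<in> {a..b}" if "t \<in> {a..b}" for t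
    using half[of t] that ab by (auto simp: abs_if split: if_splits)
  moreover have "f u = u" if "f (f u) = u" for u
    using half[of u] half[of "f u"] that by argo
  ultimately show ?thesis
    by (intro F1I assms(1)) auto
qed

text \<open>
  The points \<open>s\<^sub>i / 2\<^sup>i\<close> are isolated, so a sum of tents interpolates the shift along them;
  clipping then makes the interpolant halve distances to \<open>0\<close>.
\<close>

lemma halving_interpolation:
  fixes s :: "nat \<Rightarrow> real"
  assumes s: "\<And>i. s i \<in> {-1, 0, 1}" and s0: "\<And>i. s i = 0 \<Longrightarrow> s (Suc i) = 0"
  obtains h where "continuous_on UNIV h" "\<And>y. \<bar>h y\<bar> \<le> \<bar>y\<bar> / 2"
    "\<And>i. h (s i / 2 ^ i) = s (Suc i) / 2 ^ Suc i"
proof -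
  define x where "x = (\<lambda>i. s i / 2 ^ i)"
  \<comment> \<open>The tent has height 1 at \<open>x i\<close> and vanishes at distance
    \<open>1 / 2 ^ Suc i\<close>. Distinct nonzero points have distinct powers of two as absolute
    values, so the tent of a nonzero \<open>x i\<close> vanishes at all other nonzero
    \<open>x j\<close>.\<close>
  define tent where "tent = (\<lambda>i y. max 0 (1 - 2 ^ Suc i * \<bar>y - x i\<bar>))"
  define g where "g = (\<lambda>y. \<Sum>i. x (Suc i) * tent i y)"
  define h where "h = (\<lambda>y. max (- \<bar>y\<bar> / 2) (min (\<bar>y\<bar> / 2) (g y)))"
  have abs_s: "\<bar>s i\<bar> \<le> 1" for i using s[of i] by auto
  have abs_x: "\<bar>x i\<bar> \<le> (1 / 2) ^ i" for i
    using abs_s[of i] by (auto simp: x_def abs_mult power_divide divide_simps)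
  have tent_le: "\<bar>tent i y\<bar> \<le> 1" for i y by (auto simp: tent_def)
  \<comment> \<open>The coefficients \<open>x (Suc i)\<close> give a geometric majorant, so
    \<open>g\<close> is continuous.\<close>
  have "uniform_limit UNIV (\<lambda>n y. \<Sum>i<n. x (Suc i) * tent i y) g sequentially"
    unfolding g_def
  proof (rule Weierstrass_m_test)
    show "norm (x (Suc i) * tent i y) \<le> (1 / 2) ^ Suc i" for i y
      using mult_mono[OF abs_x[of "Suc i"] tent_le[of i y]] by (simp add: abs_mult)
    show "summable (\<lambda>i. (1 / 2 :: real) ^ Suc i)"
      by (subst summable_Suc_iff) (rule summable_geometric, simp)
  qed
  then have "continuous_on UNIV g"
    by (rule uniform_limit_theorem[rotated])
      (auto simp: tent_def intro!: always_eventually continuous_intros)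
  then have cont: "continuous_on UNIV h"
    unfolding h_def by (intro continuous_intros) auto
  have half: "\<bar>h y\<bar> \<le> \<bar>y\<bar> / 2" for y
    by (auto simp: h_def)
  have "h (x j) = x (Suc j)" for j
  proof (cases "s j = 0")
    case True
    then show ?thesis using half[of "x j"] s0[of j] by (simp add: x_def)
  next
    case False
    then have xj: "\<bar>x j\<bar> = 1 / 2 ^ j" using s[of j] by (auto simp: x_def)
    have "x (Suc i) * tent i (x j) = 0" if "i \<noteq> j" for i
    proof (cases "s i = 0")
      case False
      then have xi: "\<bar>x i\<bar> = 1 / 2 ^ i" using s[of i] by (auto simp: x_def)
      have "1 / 2 ^ Suc i \<le> \<bar>x j - x i\<bar>"
      proof (cases "i < j")
        case True
        then have "(2 :: real) ^ Suc i \<le> 2 ^ j" by (intro power_increasing) auto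
        then have "\<bar>x j\<bar> \<le> 1 / 2 ^ Suc i" unfolding xj by (intro divide_left_mono) auto
        moreover have "\<bar>x i\<bar> = 2 * (1 / 2 ^ Suc i)" by (simp add: xi)
        ultimately show ?thesis by linarith
      next
        case False
        with that have "Suc j \<le> i" by simp
        then have "(2 :: real) ^ Suc j \<le> 2 ^ i" by (intro power_increasing) auto
        then have "\<bar>x i\<bar> \<le> 1 / 2 ^ Suc j" unfolding xi by (intro divide_left_mono) auto
        moreover have "\<bar>x j\<bar> = 2 * (1 / 2 ^ Suc j)" "\<bar>x i\<bar> = 2 * (1 / 2 ^ Suc i)"
          by (simp_all add: xi xj)
        moreover have "1 / 2 ^ Suc i > (0 :: real)" by simp
        ultimately show ?thesis by linarith
      qed
      then have "1 \<le> 2 ^ Suc i * \<bar>x j - x i\<bar>"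
        by (simp add: pos_divide_le_eq mult.commute)
      then show ?thesis by (simp add: tent_def)
    qed (simp add: x_def s0)
    then have "g (x j) = x (Suc j) * tent j (x j)"
      unfolding g_def by (subst suminf_finite[of "{j}"]) auto
    then have "g (x j) = x (Suc j)" by (simp add: tent_def)
    \<comment> \<open>The prescribed value already satisfies the halving bound, so clipping does not
      change it.\<close>
    moreover have "\<bar>x (Suc j)\<bar> \<le> \<bar>x j\<bar> / 2"
      unfolding xj using abs_x[of "Suc j"] by (simp add: power_divide)
    ultimately show ?thesis by (auto simp: h_def)
  qed
  then show thesis using that cont half by (auto simp: x_def)
qed

text \<open>The sign tells on which side of the midpoint a term lies. As distances shrink, a term on
  the right (\<open>s i = 1\<close>) moves left and one on the left moves right.\<close>

lemma F1_orbit_of_signs: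
  fixes s :: "nat \<Rightarrow> real"
  assumes ab: "a < b" and s: "\<And>i. s i \<in> {-1, 0, 1}" "\<And>i. s i = 0 \<Longrightarrow> s (Suc i) = 0"
  obtains f x where "F1_orbit a b f x"
    "\<And>i. x (Suc i) = x i \<longleftrightarrow> s i = 0" "\<And>i. label_at x i = (if s i = 1 then L else R)"
proof -
  obtain h where h: "continuous_on UNIV h" "\<And>y. \<bar>h y\<bar> \<le> \<bar>y\<bar> / 2"
    "\<And>i. h (s i / 2 ^ i) = s (Suc i) / 2 ^ Suc i"
    using halving_interpolation[of s] s by metis
  \<comment> \<open>The affine map from \<open>{-1..1}\<close> onto \<open>{a..b}\<close> conjugates
    \<open>h\<close> to \<open>f\<close>.\<close>
  define p where "p = (a + b) / 2"
  define r where "r = (b - a) / 2"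
  have r: "r > 0" using ab by (simp add: r_def)
  define f where "f = (\<lambda>t. p + r * h ((t - p) / r))"
  define x where "x = (\<lambda>i. p + r * (s i / 2 ^ i))"
  have "f \<in> F1 {a..b}"
  proof (rule halving_map_in_F1[where p = p])
    show "continuous_on {a..b} f"
      unfolding f_def
      by (intro continuous_intros continuous_on_compose2[OF h(1)]) (use r in auto)
    show "\<bar>f t - p\<bar> \<le> \<bar>t - p\<bar> / 2" for t
    proof -
      have "\<bar>f t - p\<bar> = r * \<bar>h ((t - p) / r)\<bar>" using r by (simp add: f_def abs_mult)
      also have "\<dots> \<le> r * (\<bar>(t - p) / r\<bar> / 2)" using r h(2)[of "(t - p) / r"] by (intro mult_left_mono) linarith+
      also have "\<dots> = \<bar>t - p\<bar> / 2" using r by simp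
      finally show ?thesis .
    qed
  qed (use ab in \<open>auto simp: p_def field_simps\<close>)
  moreover have "is_orbit {a..b} f x"
    unfolding is_orbit_def
  proof (intro allI conjI)
    fix i
    have "\<bar>s i / 2 ^ i\<bar> \<le> 1"
      using s(1)[of i] by (auto simp: divide_simps)
    then have "\<bar>x i - p\<bar> \<le> r"
      using r mult_left_mono[of "\<bar>s i / 2 ^ i\<bar>" 1 r] by (simp add: x_def abs_mult)
    moreover have "p - r = a" "p + r = b" by (simp_all add: p_def r_def field_simps)
    ultimately show "x i \<in> {a..b}" by (auto simp: abs_le_iff)
    show "x (Suc i) = f (x i)" using r h(3)[of i] by (simp add: f_def x_def)
  qed
  ultimately have "F1_orbit a b f x" by unfold_locales
  \<comment> \<open>Since \<open>s (Suc i)\<close> has absolute value at most 1, the last factor has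
    the sign opposite to \<open>s i\<close>; it vanishes with \<open>s i\<close> because zeros
    persist.\<close>
  moreover have diff: "x (Suc i) - x i = r / 2 ^ Suc i * (s (Suc i) - 2 * s i)" for i
    using r by (simp add: x_def field_simps)
  have pos: "r / 2 ^ Suc i > 0" for i using r by simp
  have sign: "(c * d < 0 \<longleftrightarrow> d < 0) \<and> (c * d = 0 \<longleftrightarrow> d = 0)" if "c > 0" for c d :: real
    using that by (auto simp: mult_less_0_iff)
  have "x (Suc i) - x i < 0 \<longleftrightarrow> s (Suc i) - 2 * s i < 0"
    and "x (Suc i) - x i = 0 \<longleftrightarrow> s (Suc i) - 2 * s i = 0" for i
    unfolding diff using sign[OF pos] by blast+
  then have "x (Suc i) = x i \<longleftrightarrow> s i = 0" "label_at x i = (if s i = 1 then L else R)" for i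
    using s(1)[of i] s(1)[of "Suc i"] s(2)[of i] by (auto simp: label_at_def)
  ultimately show thesis using that by blast
qed

lemma ex_orbit_with_tag:
  assumes "a < b"
  shows "\<exists>f x. F1_orbit a b f x \<and> pattern_tag x = T"
proof (cases T)
  case (Inl l)
  define s :: "nat \<Rightarrow> real" where "s = (\<lambda>i. if l i = L then 1 else -1)"
  obtain f x where fx: "F1_orbit a b f x" "\<And>i. x (Suc i) = x i \<longleftrightarrow> s i = 0"
    "\<And>i. label_at x i = (if s i = 1 then L else R)"
    by (rule F1_orbit_of_signs[OF assms, of s]) (auto simp: s_def split: if_splits)
  moreover have "label_at x = l"
  proof
    show "label_at x i = l i" for i by (cases "l i") (auto simp: fx(3) s_def)
  qed
  ultimately show ?thesis
    using Inl by (intro exI[of _ f] exI[of _ x]) (auto simp: pattern_tag_def s_def)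
next
  case (Inr w)
  \<comment> \<open>The default 0 puts the orbit on the fixed midpoint exactly from index
    \<open>length w\<close> on.\<close>
  define s :: "nat \<Rightarrow> real" where
    "s = (\<lambda>i. if i < length w then if w ! i = L then 1 else -1 else 0)"
  obtain f x where fx: "F1_orbit a b f x" "\<And>i. x (Suc i) = x i \<longleftrightarrow> s i = 0"
    "\<And>i. label_at x i = (if s i = 1 then L else R)"
    by (rule F1_orbit_of_signs[OF assms, of s]) (auto simp: s_def split: if_splits)
  have stat: "x (Suc i) = x i \<longleftrightarrow> length w \<le> i" for i
    using fx(2)[of i] by (auto simp: s_def)
  have "(LEAST k. x (Suc k) = x k) = length w"
    by (rule Least_equality) (auto simp: stat)
  moreover have "map (label_at x) [0..<length w] = w"
  proof (rule nth_equalityI)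
    show "map (label_at x) [0..<length w] ! i = w ! i"
      if "i < length (map (label_at x) [0..<length w])" for i
      using that by (cases "w ! i") (auto simp: fx(3) s_def)
  qed simp
  ultimately have "pattern_tag x = T"
    using Inr stat by (auto simp: pattern_tag_def)
  then show ?thesis using fx(1) by blast
qed

section \<open>The bijection between orbit-patterns and tags\<close>

theorem mainTheorem1:
  fixes a b :: real
  assumes "a < b"
  shows "\<exists>\<phi> :: (nat \<Rightarrow> real) set \<Rightarrow> tag.
           (\<forall>f x. f \<in> F1 {a..b} \<and> is_orbit {a..b} f x \<longrightarrow> \<phi> (order_pattern x) = LR_tag x) \<and>
           bij_betw \<phi> (orbit_patterns {a..b}) J"
proof (intro exI conjI allI impI)
  \<comment> \<open>The chosen representative need not be an orbit, but \<open>pattern_tag\<close>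
    makes sense for every sequence and is constant on each class.\<close>
  let ?\<phi> = "\<lambda>P. pattern_tag (SOME x. x \<in> P)"
  have \<phi>: "?\<phi> (order_pattern x) = pattern_tag x" for x
  proof -
    have "x \<in> order_pattern x" by (simp add: order_pattern_def same_order_pattern_def)
    then have "(SOME y. y \<in> order_pattern x) \<in> order_pattern x" by (rule someI[where P = "\<lambda>y. y \<in> order_pattern x"])
    then show ?thesis by (auto simp: order_pattern_def intro: pattern_tag_cong[symmetric])
  qed
  show "?\<phi> (order_pattern x) = LR_tag x" if "f \<in> F1 {a..b} \<and> is_orbit {a..b} f x" for f x
    using \<phi> F1_orbit.LR_tag_eq_pattern_tag[of a b f x] that by (simp add: F1_orbit_def)
  have patterns: "orbit_patterns {a..b} = {order_pattern x | f x. F1_orbit a b f x}"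
    by (simp add: orbit_patterns_def F1_orbit_def)
  show "bij_betw ?\<phi> (orbit_patterns {a..b}) J"
    unfolding bij_betw_def
  proof
    show "inj_on ?\<phi> (orbit_patterns {a..b})"
    proof (rule inj_onI)
      fix P Q assume "P \<in> orbit_patterns {a..b}" "Q \<in> orbit_patterns {a..b}" and eq: "?\<phi> P = ?\<phi> Q"
      then obtain f x g y where xy: "F1_orbit a b f x" "P = order_pattern x"
        "F1_orbit a b g y" "Q = order_pattern y"
        unfolding patterns by blast
      then have "(x, y) \<in> same_order_pattern"
        using eq \<phi> same_order_pattern_if_tag_eq by metis
      then show "P = Q"
        using xy equiv_class_eq[OF equiv_same_order_pattern] by (simp add: order_pattern_def)
    qed
    have "T \<in> ?\<phi> ` orbit_patterns {a..b}" for T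
    proof -
      obtain f x where "F1_orbit a b f x" "pattern_tag x = T"
        using ex_orbit_with_tag[OF assms] by blast
      then show ?thesis unfolding patterns using \<phi> by (intro image_eqI[of _ _ "order_pattern x"]) auto
    qed
    then show "?\<phi> ` orbit_patterns {a..b} = J"
      by (auto simp: J_def UNIV_Plus_UNIV)
  qed
qed

end
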